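(* Let $S$ be a modal Kleene algebra whose test algebra $\mathrm{test}(S)$ is a complete lattice, and let $a,b\in S$. If $a+b$ is Noetherian and $a$ and $b$ locally d-commute, i.e. $\langle b|\,|a\rangle\le |a^*\rangle\,\langle b^*|$, then $a$ and $b$ d-commute, i.e. $\langle b^*|\,|a^*\rangle\le |a^*\rangle\,\langle b^*|$.
   Context: An idempotent semiring is a structure $(S,+,\cdot,0,1)$ such that $(S,+,0)$ is a commutative monoid with $a+a=a$, $(S,\cdot,1)$ is a monoid, multiplication distributes over addition from both sides, and $0a=a0=0$; natural order $a\le b\iff a+b=b$. A test is an element $p\le 1$ for which some $q$ satisfies $p+q=1$ and $pq=0=qp$; $q$ is unique, written $\neg p$; tests form a Boolean algebra $\mathrm{test}(S)$ (join $+$, meet $\cdot$); $p-q=p\cdot\neg q$. $S$ is a modal semiring if for each $a\in S$ there are maps $|a\rangle$ (forward diamond) and $\langle a|$ (backward diamond) on $\mathrm{test}(S)$ with, for all $a,b,p,q$: $|a\rangle p\le q\iff \neg q\,a\,p\le 0$; $\langle a|p\le q\iff p\,a\,\neg q\le 0$; $|ab\rangle p=|a\rangle(|b\rangle p)$; $\langle ab|p=\langle b|(\langle a|p)$. Maps on tests are ordered pointwise; juxtaposition denotes composition. A Kleene algebra is an idempotent semiring with ${}^*$ such that $1+aa^*\le a^*$, $b+ac\le c\Rightarrow a^*b\le c$, $1+a^*a\le a^*$, $b+ca\le c\Rightarrow ba^*\le c$. A modal Kleene algebra is a Kleene algebra that is a modal semiring. An element $c$ is Noetherian if for all tests $p$,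 $p-|c\rangle p\le 0$ implies $p\le 0$. *)

theory Defs
  imports Main "HOL-Algebra.Complete_Lattice"
begin

(* The library class semiring_1 is avoided on purpose: it would add the assumption 0 \<noteq> 1. *)
class idempotent_semiring = semiring_0 + monoid_mult + ord +
  assumes add_idem: "a + a = a"
    and natural_le: "a \<le> b \<longleftrightarrow> a + b = b"
    and natural_less: "a < b \<longleftrightarrow> a \<le> b \<and> a \<noteq> b"
begin

subclass order
proof
  fix x y z :: 'a
  show "x < y \<longleftrightarrow> x \<le> y \<and> \<not> y \<le> x"
    by (metis natural_le natural_less add.commute)
  show "x \<le> x"
    by (simp add: natural_le add_idem)
  show "x \<le> y \<Longrightarrow> y \<le> z \<Longrightarrow> x \<le> z"
    by (metis natural_le add.assoc)
  show "x \<le> y \<Longrightarrow> y \<le> x \<Longrightarrow> x = y"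
    by (metis natural_le add.commute)
qed

definition is_complement :: "'a \<Rightarrow> 'a \<Rightarrow> bool" where
  "is_complement p q \<longleftrightarrow> p + q = 1 \<and> p * q = 0 \<and> q * p = 0"

definition tests :: "'a set" where
  "tests = {p. p \<le> 1 \<and> (\<exists>q. is_complement p q)}"

lemma is_complement_unique:
  assumes "is_complement p q" and "is_complement p r"
  shows "q = r"
proof -
  have "q = q * (p + r)"
    using assms by (simp add: is_complement_def)
  also have "\<dots> = q * r"
    using assms unfolding distrib_left by (simp add: is_complement_def)
  also have "\<dots> = (p + q) * r"
    using assms unfolding distrib_right by (simp add: is_complement_def)
  also have "\<dots> = r"
    using assms by (simp add: is_complement_def)
  finally show ?thesis .
qed

definition neg :: "'a \<Rightarrow> 'a" where
  "neg p = (THE q. is_complement p q)"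

lemma is_complement_neg: "p \<in> tests \<Longrightarrow> is_complement p (neg p)"
  unfolding tests_def neg_def by (auto intro: theI is_complement_unique)

definition test_diff :: "'a \<Rightarrow> 'a \<Rightarrow> 'a" where
  "test_diff p q = p * neg q"

definition test_order :: "'a gorder" where
  "test_order = \<lparr>carrier = tests, eq = (=), le = (\<le>)\<rparr>"

definition test_map_le :: "('a \<Rightarrow> 'a) \<Rightarrow> ('a \<Rightarrow> 'a) \<Rightarrow> bool" where
  "test_map_le f g \<longleftrightarrow> (\<forall>p\<in>tests. f p \<le> g p)"

end

(* fdia a p stands for |a>p and bdia a p for <a|p.  Both are maps on tests only;
   their values on other elements are left unconstrained. *)
class modal_semiring = idempotent_semiring +
  fixes fdia :: "'a \<Rightarrow> 'a \<Rightarrow> 'a"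
    and bdia :: "'a \<Rightarrow> 'a \<Rightarrow> 'a"
  assumes fdia_closed: "p \<in> tests \<Longrightarrow> fdia a p \<in> tests"
    and bdia_closed: "p \<in> tests \<Longrightarrow> bdia a p \<in> tests"
    and fdia_le: "\<lbrakk>p \<in> tests; q \<in> tests\<rbrakk> \<Longrightarrow> fdia a p \<le> q \<longleftrightarrow> neg q * a * p \<le> 0"
    and bdia_le: "\<lbrakk>p \<in> tests; q \<in> tests\<rbrakk> \<Longrightarrow> bdia a p \<le> q \<longleftrightarrow> p * a * neg q \<le> 0"
    and fdia_mult: "p \<in> tests \<Longrightarrow> fdia (a * b) p = fdia a (fdia b p)"
    and bdia_mult: "p \<in> tests \<Longrightarrow> bdia (a * b) p = bdia b (bdia a p)"
begin

definition noetherian :: "'a \<Rightarrow> bool" where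
  "noetherian c \<longleftrightarrow> (\<forall>p\<in>tests. test_diff p (fdia c p) \<le> 0 \<longrightarrow> p \<le> 0)"

end

class kleene_algebra = idempotent_semiring +
  fixes star :: "'a \<Rightarrow> 'a"
  assumes star_unfold_left: "1 + a * star a \<le> star a"
    and star_induct_left: "b + a * c \<le> c \<Longrightarrow> star a * b \<le> c"
    and star_unfold_right: "1 + star a * a \<le> star a"
    and star_induct_right: "b + c * a \<le> c \<Longrightarrow> b * star a \<le> c"

class modal_kleene_algebra = kleene_algebra + modal_semiring
begin

definition locally_d_commute :: "'a \<Rightarrow> 'a \<Rightarrow> bool" where
  "locally_d_commute a b \<longleftrightarrow>
     test_map_le (bdia b \<circ> fdia a) (fdia (star a) \<circ> bdia (star b))"

definition d_commute :: "'a \<Rightarrow> 'a \<Rightarrow> bool" where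
  "d_commute a b \<longleftrightarrow>
     test_map_le (bdia (star b) \<circ> fdia (star a)) (fdia (star a) \<circ> bdia (star b))"

end

end

(* Call a test x commuting if <b*|(x |a*>p) <= |a*><b*|p for all tests p.  The condition says that x
   annihilates certain elements from the left, so by the Galois connection it passes to arbitrary
   suprema; let r be the supremum of all commuting tests.  If all (a+b)-successors of x lie in r,
   then unfolding both stars once, closing the local peak by local commutation and applying the
   commuting property of r twice shows that x is commuting, hence x <= r.  Taking the largest such x,
   this says that neg r <= |a+b>(neg r), so neg r = 0 because a+b is Noetherian, and 1 is commuting. *)

theory Submission
  imports Defs
begin

section \<open>The Boolean algebra of tests\<close>

context idempotent_semiring
begin

lemma le_zero_iff: "x \<le> 0 \<longleftrightarrow> x = 0"
  by (simp add: natural_le)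

lemma mult_isol: "x \<le> y \<Longrightarrow> z * x \<le> z * y"
  by (metis natural_le distrib_left)

lemma mult_isor: "x \<le> y \<Longrightarrow> x * z \<le> y * z"
  by (metis natural_le distrib_right)

lemma mult_iso: "x \<le> y \<Longrightarrow> z \<le> w \<Longrightarrow> x * z \<le> y * w"
  by (meson mult_isol mult_isor order_trans)

lemma add_le_iff: "x + y \<le> z \<longleftrightarrow> x \<le> z \<and> y \<le> z"
  by (metis natural_le add.assoc add.commute add_idem)

lemma le_add1: "x \<le> x + y" and le_add2: "y \<le> x + y"
  using add_le_iff by blast+

lemma is_complement_sym: "is_complement p q \<Longrightarrow> is_complement q p"
  by (simp add: is_complement_def add.commute)

lemma test_le_one: "p \<in> tests \<Longrightarrow> p \<le> 1"
  by (simp add: tests_def)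

lemma is_complement_tests: "is_complement p q \<Longrightarrow> p \<in> tests"
  unfolding tests_def by (metis (mono_tags, lifting) is_complement_def le_add1 mem_Collect_eq)

lemma neg_eq: "is_complement p q \<Longrightarrow> neg p = q"
  by (meson is_complement_neg is_complement_tests is_complement_unique)

lemma neg_tests: "p \<in> tests \<Longrightarrow> neg p \<in> tests"
  by (meson is_complement_neg is_complement_sym is_complement_tests)

lemma neg_neg: "p \<in> tests \<Longrightarrow> neg (neg p) = p"
  by (meson is_complement_neg is_complement_sym neg_eq)

lemma one_tests: "1 \<in> tests"
  by (rule is_complement_tests [of _ 0]) (simp add: is_complement_def)

lemma test_add_neg: "p \<in> tests \<Longrightarrow> p + neg p = 1"
  and test_mult_neg: "p \<in> tests \<Longrightarrow> p * neg p = 0"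
  and neg_mult_test: "p \<in> tests \<Longrightarrow> neg p * p = 0"
  using is_complement_neg unfolding is_complement_def by auto

lemma test_idem: "p \<in> tests \<Longrightarrow> p * p = p"
  by (metis add_0_right distrib_left mult_1_right test_add_neg test_mult_neg)

lemma test_mult_le1: "p \<in> tests \<Longrightarrow> p * x \<le> x"
  using mult_isor test_le_one by fastforce

lemma test_mult_le2: "p \<in> tests \<Longrightarrow> x * p \<le> x"
  using mult_isol test_le_one by fastforce

text \<open>Because \<open>q\<close> lies below 1, \<open>p * q * neg p\<close> is below
  \<open>p * neg p = 0\<close>, and dually \<open>neg p * (q * p) = 0\<close>. Splitting 1 as
  \<open>p + neg p\<close> then turns both products into \<open>p * q * p\<close>.\<close>

lemma test_mult_comm:
  assumes "p \<in> tests" "q \<in> tests"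
  shows "p * q = q * p"
proof -
  have "p * q * neg p \<le> p * neg p" "neg p * (q * p) \<le> neg p * p"
    by (simp_all add: mult_isor mult_isol test_mult_le1 test_mult_le2 assms)
  then have "p * q * neg p = 0" "neg p * (q * p) = 0"
    by (simp_all add: test_mult_neg neg_mult_test le_zero_iff assms)
  moreover have "p * q * (p + neg p) = p * q" "(p + neg p) * (q * p) = q * p"
    by (simp_all add: test_add_neg assms)
  ultimately have "p * q * p = p * q" "p * (q * p) = q * p"
    by (metis add_0_right distrib_left, metis add_0_right distrib_right)
  then show ?thesis by (simp add: mult.assoc)
qed

text \<open>De Morgan's law and closure come together: \<open>neg p * neg q\<close> is verified
  directly to be a complement of \<open>p + q\<close>, and complements are unique.\<close>

lemma
  assumes p: "p \<in> tests" and q: "q \<in> tests"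
  shows tests_add: "p + q \<in> tests" and neg_add: "neg (p + q) = neg p * neg q"
proof -
  \<comment> \<open>Writing \<open>q\<close> as \<open>(p + neg p) * q\<close> lets \<open>p\<close>
    absorb \<open>p * q\<close>, while \<open>neg p * q\<close> joins \<open>neg p * neg q\<close>
    to give \<open>neg p\<close>.\<close>
  have "p + q + neg p * neg q = p + (p + neg p) * q + neg p * neg q"
    by (simp add: test_add_neg p)
  also have "\<dots> = p * (1 + q) + neg p * (q + neg q)"
    by (simp add: distrib_left distrib_right ac_simps)
  also have "\<dots> = 1"
    using test_add_neg [OF p] test_add_neg [OF q] test_le_one [OF q]
    by (metis add.commute mult_1_right natural_le)
  finally have "p + q + neg p * neg q = 1" .
  moreover have "(p + q) * (neg p * neg q) = p * neg p * neg q + q * neg q * neg p"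
    by (simp add: distrib_right mult.assoc test_mult_comm [OF neg_tests neg_tests] p q)
  moreover have "neg p * neg q * (p + q) = neg q * (neg p * p) + neg p * (neg q * q)"
    using test_mult_comm [OF neg_tests neg_tests, OF p q]
    by (simp add: distrib_left) (metis mult.assoc)
  ultimately have "is_complement (p + q) (neg p * neg q)"
    by (simp add: is_complement_def test_mult_neg neg_mult_test p q)
  then show "p + q \<in> tests" "neg (p + q) = neg p * neg q"
    by (auto intro: is_complement_tests neg_eq)
qed

lemma tests_mult: "p \<in> tests \<Longrightarrow> q \<in> tests \<Longrightarrow> p * q \<in> tests"
  by (metis neg_add neg_neg neg_tests tests_add)

lemma test_le_iff:
  assumes "p \<in> tests" "q \<in> tests"
  shows "p \<le> q \<longleftrightarrow> p * neg q = 0"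
proof
  show "p * neg q = 0" if "p \<le> q"
    by (metis assms(2) le_zero_iff mult_isor test_mult_neg that)
next
  assume "p * neg q = 0"
  then have "p = p * q"
    by (metis add_0_right assms(2) distrib_left mult_1_right test_add_neg)
  then show "p \<le> q"
    by (metis assms(1) test_mult_le1)
qed

lemma test_le_mult: "p \<in> tests \<Longrightarrow> p \<le> x \<Longrightarrow> p \<le> y \<Longrightarrow> p \<le> x * y"
  by (metis mult_iso test_idem)

end

section \<open>Monotonicity, sums and restriction of diamonds\<close>

context modal_semiring
begin

lemma fdia_neg_zero: "p \<in> tests \<Longrightarrow> neg (fdia a p) * a * p = 0"
  by (metis fdia_closed fdia_le le_zero_iff order_refl)

lemma bdia_neg_zero: "p \<in> tests \<Longrightarrow> p * a * neg (bdia a p) = 0"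
  by (metis bdia_closed bdia_le le_zero_iff order_refl)

lemma fdia_mono:
  assumes "p \<in> tests" "q \<in> tests" "p \<le> q"
  shows "fdia a p \<le> fdia a q"
proof -
  have "neg (fdia a q) * a * p \<le> 0"
    by (metis assms(2,3) fdia_neg_zero mult_isol)
  then show ?thesis
    by (simp add: assms fdia_closed fdia_le)
qed

lemma bdia_mono:
  assumes "p \<in> tests" "q \<in> tests" "p \<le> q"
  shows "bdia a p \<le> bdia a q"
proof -
  have "p * a * neg (bdia a q) \<le> 0"
    by (metis assms(2,3) bdia_neg_zero mult_isor mult.assoc)
  then show ?thesis
    by (simp add: assms bdia_closed bdia_le)
qed

lemma fdia_mono_act:
  assumes "p \<in> tests" "a \<le> b"
  shows "fdia a p \<le> fdia b p"
proof -
  have "neg (fdia b p) * a * p \<le> 0"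
    by (metis assms fdia_neg_zero mult_isol mult_isor)
  then show ?thesis
    by (simp add: assms fdia_closed fdia_le)
qed

lemma bdia_mono_act:
  assumes "p \<in> tests" "a \<le> b"
  shows "bdia a p \<le> bdia b p"
proof -
  have "p * a * neg (bdia b p) \<le> 0"
    by (metis assms bdia_neg_zero mult_isol mult_isor)
  then show ?thesis
    by (simp add: assms bdia_closed bdia_le)
qed

lemma fdia_one: "p \<in> tests \<Longrightarrow> fdia 1 p = p"
  by (rule order.antisym)
    (simp_all add: fdia_le neg_mult_test, metis fdia_closed fdia_neg_zero mult_1_right neg_neg
      neg_tests test_le_iff test_mult_comm)

lemma bdia_one: "p \<in> tests \<Longrightarrow> bdia 1 p = p"
  by (rule order.antisym)
    (simp_all add: bdia_le test_mult_neg, metis bdia_closed bdia_neg_zero mult_1_right test_le_iff)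

lemma fdia_add_le: "p \<in> tests \<Longrightarrow> fdia (a + b) p \<le> fdia a p + fdia b p"
proof -
  assume p: "p \<in> tests"
  have "neg (fdia a p) * neg (fdia b p) * (a + b) * p
      = neg (fdia b p) * (neg (fdia a p) * a * p) + neg (fdia a p) * (neg (fdia b p) * b * p)"
    using test_mult_comm [OF neg_tests neg_tests, OF fdia_closed fdia_closed, OF p p, of a b]
    by (simp add: distrib_left distrib_right mult.assoc) (metis mult.assoc)
  also have "\<dots> = 0"
    by (simp add: fdia_neg_zero p)
  finally show ?thesis
    by (simp add: fdia_le tests_add fdia_closed neg_add p)
qed

lemma bdia_add_le_iff:
  "p \<in> tests \<Longrightarrow> q \<in> tests \<Longrightarrow> bdia (a + b) p \<le> q \<longleftrightarrow> bdia a p \<le> q \<and> bdia b p \<le> q"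
  by (simp add: bdia_le distrib_left distrib_right add_le_iff)

text \<open>The hypothesis \<open>step\<close> says that every a-step from \<open>x\<close> ends in
  \<open>r\<close>, so \<open>x * a = x * a * r\<close> and \<open>r\<close> may be inserted in
  front of \<open>q\<close>.\<close>

lemma test_mult_fdia_le:
  assumes x: "x \<in> tests" and r: "r \<in> tests" and q: "q \<in> tests"
    and step: "x * a * neg r = 0"
  shows "x * fdia a q \<le> fdia a (r * q)"
proof -
  define w where "w = fdia a (r * q)"
  have w: "w \<in> tests"
    by (simp add: w_def fdia_closed tests_mult r q)
  have "x * a = x * a * r"
    by (metis add_0_right distrib_left mult_1_right r step test_add_neg)
  then have "neg w * x * a * q = neg w * (x * (a * (r * q)))"
    by (metis mult.assoc)
  also have "\<dots> = x * (neg w * a * (r * q))"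
    by (metis mult.assoc neg_tests test_mult_comm w x)
  also have "\<dots> = 0"
    by (simp add: w_def fdia_neg_zero tests_mult r q)
  \<comment> \<open>The Galois connection applies only to a bare diamond, so the factor
    \<open>x\<close> is first moved to the right side as \<open>neg x\<close>.\<close>
  finally have "fdia a q \<le> w + neg x"
    by (simp add: fdia_le tests_add neg_add neg_neg neg_tests q w x mult.assoc)
  then have "x * fdia a q \<le> x * (w + neg x)"
    by (rule mult_isol)
  also have "\<dots> \<le> w"
    by (simp add: distrib_left test_mult_neg test_mult_le1 x)
  finally show ?thesis
    by (simp add: w_def)
qed

lemma bdia_test_mult_le:
  assumes x: "x \<in> tests" and r: "r \<in> tests" and s: "s \<in> tests"
    and step: "x * b * neg r = 0"
  shows "bdia b (x * s) \<le> r * bdia b s"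
proof (rule test_le_mult)
  show "bdia b (x * s) \<in> tests"
    by (simp add: bdia_closed tests_mult x s)
  have "x * s * b * neg r = 0"
    by (metis mult.assoc mult_zero_right s step test_mult_comm x)
  then show "bdia b (x * s) \<le> r"
    by (simp add: bdia_le tests_mult x r s)
  show "bdia b (x * s) \<le> bdia b s"
    by (simp add: bdia_mono tests_mult x s test_mult_le1)
qed

text \<open>The test \<open>neg (fdia a 1)\<close> is the antidomain of \<open>a\<close>, its
  greatest left annihilator among tests. Annihilation thus becomes an upper bound in the test
  algebra.\<close>

lemma test_annihilates_iff:
  assumes "x \<in> tests"
  shows "x * a = 0 \<longleftrightarrow> x \<le> neg (fdia a 1)"
proof -
  have "x * a = 0 \<longleftrightarrow> fdia a 1 \<le> neg x"
    by (simp add: fdia_le one_tests neg_tests neg_neg assms le_zero_iff)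
  also have "\<dots> \<longleftrightarrow> x \<le> neg (fdia a 1)"
    by (metis assms fdia_closed neg_neg neg_tests one_tests test_le_iff test_mult_comm)
  finally show ?thesis .
qed

end

section \<open>Unfolding of the star\<close>

context kleene_algebra
begin

text \<open>The right side is closed under the map sending c to \<open>1 + a * c\<close>, so star
  induction applies with b = 1.\<close>

lemma star_unfold_left_le: "star a \<le> 1 + a * star a"
proof -
  have "1 + a * (1 + a * star a) \<le> 1 + a * star a"
    by (metis add_le_iff le_add1 le_add2 mult_isol order_trans star_unfold_left)
  then show ?thesis
    using star_induct_left by fastforce
qed

lemma one_le_star: "1 \<le> star a"
  using star_unfold_left add_le_iff by blast

lemma mult_star_le_star: "a * star a \<le> star a"
  using star_unfold_left add_le_iff by blast

lemma star_mult_star_le: "star a * star a \<le> star a"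
  by (rule star_induct_left) (simp add: add_le_iff mult_star_le_star)

end

section \<open>Diamonds of stars and commuting tests\<close>

context modal_kleene_algebra
begin

lemma fdia_star_unfold_le: "p \<in> tests \<Longrightarrow> fdia (star a) p \<le> p + fdia a (fdia (star a) p)"
  using fdia_mono_act [OF _ star_unfold_left_le] fdia_add_le [of p 1 "a * star a"]
  by (metis fdia_mult fdia_one order_trans)

lemma bdia_star_le:
  assumes "p \<in> tests" "q \<in> tests" "p \<le> q" "bdia (star b) (bdia b p) \<le> q"
  shows "bdia (star b) p \<le> q"
proof -
  have "bdia (1 + b * star b) p \<le> q"
    by (simp add: assms bdia_add_le_iff bdia_one bdia_mult)
  then show ?thesis
    using bdia_mono_act [OF assms(1) star_unfold_left_le] order_trans by blast
qed

lemma le_fdia_star: "p \<in> tests \<Longrightarrow> p \<le> fdia (star a) p"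
  by (metis fdia_mono_act fdia_one one_le_star)

lemma le_bdia_star: "p \<in> tests \<Longrightarrow> p \<le> bdia (star a) p"
  by (metis bdia_mono_act bdia_one one_le_star)

lemma fdia_star_star_le: "p \<in> tests \<Longrightarrow> fdia (star a) (fdia (star a) p) \<le> fdia (star a) p"
  by (metis fdia_mono_act fdia_mult star_mult_star_le)

lemma bdia_star_star_le: "p \<in> tests \<Longrightarrow> bdia (star a) (bdia (star a) p) \<le> bdia (star a) p"
  by (metis bdia_mono_act bdia_mult star_mult_star_le)

text \<open>This is d-commutation restricted to peaks whose top lies in \<open>x\<close>.\<close>

definition commutes_at :: "'a \<Rightarrow> 'a \<Rightarrow> 'a \<Rightarrow> bool" where
  "commutes_at a b x \<longleftrightarrow>
     (\<forall>p\<in>tests. bdia (star b) (x * fdia (star a) p) \<le> fdia (star a) (bdia (star b) p))"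

lemma d_commute_iff_commutes_at_one: "d_commute a b \<longleftrightarrow> commutes_at a b 1"
  by (simp add: d_commute_def commutes_at_def test_map_le_def)

text \<open>For fixed \<open>p\<close>, the Galois connection for \<open>bdia\<close> turns the
  commuting condition into \<open>x * e = 0\<close> with an \<open>e\<close> that does not depend on
  \<open>x\<close>; the bound is the antidomain of \<open>e\<close>.\<close>

lemma commutes_at_iff_bounds:
  assumes "x \<in> tests"
  shows "commutes_at a b x \<longleftrightarrow>
    (\<forall>p\<in>tests. x \<le> neg (fdia (fdia (star a) p * star b * neg (fdia (star a) (bdia (star b) p))) 1))"
  by (simp add: commutes_at_def bdia_le assms tests_mult fdia_closed bdia_closed le_zero_iff
      mult.assoc flip: test_annihilates_iff)

lemma commutes_at_lub:
  assumes lub: "least (test_order :: 'a gorder) r (Upper test_order {x \<in> tests. commutes_at a b x})"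
  shows "commutes_at a b r"
proof -
  have r: "r \<in> tests"
    using least_closed [OF lub] by (simp add: test_order_def)
  \<comment> \<open>An antidomain above all commuting tests is itself a test, so it competes with
    the least upper bound \<open>r\<close>.\<close>
  have "r \<le> neg (fdia e 1)" if "\<And>x. x \<in> tests \<Longrightarrow> commutes_at a b x \<Longrightarrow> x \<le> neg (fdia e 1)" for e
  proof -
    have "neg (fdia e 1) \<in> Upper test_order {x \<in> tests. commutes_at a b x}"
      using that by (auto simp: Upper_def test_order_def neg_tests fdia_closed one_tests)
    then show ?thesis
      using lub by (auto simp: least_def test_order_def)
  qed
  then show ?thesis
    using r commutes_at_iff_bounds by blast
qed

text \<open>A peak at \<open>x\<close> either lacks an a-step (\<open>base\<close>), lacks a b-step,
  or starts with one step of each (\<open>peak\<close>). In the last case both first steps end in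
  \<open>r\<close>, so the two peaks left after closing the local one are covered by
  \<open>comm\<close>.\<close>

lemma commutes_at_step:
  assumes x: "x \<in> tests" and r: "r \<in> tests"
    and local: "locally_d_commute a b" and comm: "commutes_at a b r"
    and stepa: "x * a * neg r = 0" and stepb: "x * b * neg r = 0"
  shows "commutes_at a b x"
  unfolding commutes_at_def
proof
  fix p assume p: "p \<in> tests"
  define s u where "s = fdia (star a) p" and "u = fdia (star a) (bdia (star b) p)"
  have s: "s \<in> tests" and u: "u \<in> tests"
    by (simp_all add: s_def u_def p fdia_closed bdia_closed)
  note closed = x r p s u fdia_closed bdia_closed tests_mult
  have comm': "bdia (star b) (r * fdia (star a) q) \<le> fdia (star a) (bdia (star b) q)"
    if "q \<in> tests" for q
    using comm that by (simp add: commutes_at_def)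
  have su: "s \<le> u"
    unfolding s_def u_def by (simp add: closed fdia_mono le_bdia_star)
  have base: "bdia (star b) (x * p) \<le> u"
  proof -
    have "bdia (star b) (x * p) \<le> bdia (star b) p"
      by (simp add: closed bdia_mono test_mult_le1)
    also have "\<dots> \<le> u"
      by (simp add: u_def closed le_fdia_star)
    finally show ?thesis .
  qed
  have peak: "bdia b (x * fdia a s) \<le> r * fdia (star a) (bdia (star b) p)"
  proof -
    \<comment> \<open>Two copies of \<open>x\<close> are needed: one records that the b-step ends in
      \<open>r\<close>, the other that the a-step does.\<close>
    have "bdia b (x * fdia a s) = bdia b (x * (x * fdia a s))"
      by (metis mult.assoc test_idem x)
    also have "\<dots> \<le> r * bdia b (x * fdia a s)"
      by (simp add: closed bdia_test_mult_le stepb)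
    also have "\<dots> \<le> r * bdia b (fdia a (r * s))"
      by (intro mult_isol bdia_mono test_mult_fdia_le stepa closed)
    also have "\<dots> \<le> r * fdia (star a) (bdia (star b) (r * s))"
      using local by (intro mult_isol) (simp add: locally_d_commute_def test_map_le_def closed)
    \<comment> \<open>First use of \<open>comm\<close>, on the a-side of the closed local
      peak.\<close>
    also have "\<dots> \<le> r * fdia (star a) u"
      using comm' [OF p] by (intro mult_isol fdia_mono closed) (simp add: s_def u_def)
    also have "\<dots> \<le> r * u"
      unfolding u_def by (intro mult_isol fdia_star_star_le closed)
    finally show ?thesis
      by (simp add: u_def)
  qed
  have "bdia (star b) (bdia b (x * fdia a s))
      \<le> bdia (star b) (r * fdia (star a) (bdia (star b) p))"
    by (intro bdia_mono peak closed)
  \<comment> \<open>Second use of \<open>comm\<close>, now at the test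
    \<open>bdia (star b) p\<close>; the leading \<open>r\<close> was kept in \<open>peak\<close> for
    this.\<close>
  also have "\<dots> \<le> fdia (star a) (bdia (star b) (bdia (star b) p))"
    by (intro comm' closed)
  also have "\<dots> \<le> u"
    unfolding u_def by (intro fdia_mono bdia_star_star_le closed)
  finally have "bdia (star b) (bdia b (x * fdia a s)) \<le> u" .
  moreover have "x * fdia a s \<le> u"
  proof -
    have "fdia a s \<le> s"
      unfolding s_def by (metis fdia_mono_act fdia_mult mult_star_le_star p)
    then show ?thesis
      using su test_mult_le1 [OF x] order_trans by blast
  qed
  ultimately have step: "bdia (star b) (x * fdia a s) \<le> u"
    using bdia_star_le [OF _ u] by (simp add: closed)
  have "x * s \<le> x * p + x * fdia a s"
    using mult_isol [OF fdia_star_unfold_le [OF p]] by (simp add: s_def distrib_left)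
  then have "bdia (star b) (x * s) \<le> bdia (star b) (x * p + x * fdia a s)"
    by (intro bdia_mono tests_add closed)
  also have "\<dots> \<le> u"
    using base step by (simp add: bdia_le closed tests_add distrib_right add_le_iff)
  finally show "bdia (star b) (x * fdia (star a) p) \<le> fdia (star a) (bdia (star b) p)"
    by (simp add: s_def u_def)
qed

end

theorem theorem11p2:
  fixes a b :: "'a::modal_kleene_algebra"
  assumes "complete_lattice (test_order :: 'a gorder)"
    and "noetherian (a + b)"
    and "locally_d_commute a b"
  shows "d_commute a b"
proof -
  let ?C = "{x \<in> tests. commutes_at a b x}"
  interpret L: complete_lattice "test_order :: 'a gorder"
    by (rule assms(1))
  have "?C \<subseteq> carrier test_order"
    by (auto simp: test_order_def)
  then obtain r where lub: "least test_order r (Upper test_order ?C)"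
    using L.sup_exists by blast
  have r: "r \<in> tests"
    using least_closed [OF lub] by (simp add: test_order_def)
  have comm: "commutes_at a b r"
    by (rule commutes_at_lub [OF lub])
  \<comment> \<open>The largest test all of whose (a+b)-successors lie in \<open>r\<close>.\<close>
  define x where "x = neg (fdia (a + b) (neg r))"
  have x: "x \<in> tests"
    by (simp add: x_def r neg_tests fdia_closed)
  have "x * a * neg r + x * b * neg r = 0"
    using fdia_neg_zero [OF neg_tests [OF r], of "a + b"]
    by (simp add: x_def distrib_left distrib_right)
  then have "x * a * neg r = 0" "x * b * neg r = 0"
    by (metis le_add1 le_zero_iff, metis \<open>_ = 0\<close> le_add2 le_zero_iff)
  then have "x \<in> ?C"
    using commutes_at_step [OF x r assms(3) comm] x by simp
  then have "x \<le> r"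
    using lub by (auto simp: least_def Upper_def test_order_def)
  then have "neg r * x = 0"
    by (metis r x neg_tests test_le_iff test_mult_comm)
  \<comment> \<open>By the choice of \<open>x\<close>, the product \<open>neg r * x\<close> is
    exactly \<open>test_diff (neg r) (fdia (a + b) (neg r))\<close>.\<close>
  then have "neg r = 0"
    using assms(2) neg_tests [OF r]
    by (simp add: noetherian_def test_diff_def x_def le_zero_iff)
  then have "r = 1"
    using test_add_neg [OF r] by simp
  then show ?thesis
    using comm by (simp add: d_commute_iff_commutes_at_one)
qed

end
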